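(* Let $0\le k\le m$ and $n\ge2$ be integers. For every tensor field $f\in\mathcal S(\mathbb R^n;S^m)$, $$(N_m^kf)_{i_1\dots i_m}(x)=2\sum_{l=0}^k\binom{k}{l}\,(x^{k+l}f)^{j_1\dots j_mp_1\dots p_{k+l}}\ast\frac{(x^{2m+k+l})_{i_1\dots i_mj_1\dots j_mp_1\dots p_{k+l}}}{|x|^{2m+2l+n-1}},$$ where $\ast$ denotes the convolution on $\mathbb R^n$ and summation over the repeated indices $j_1,\dots,j_m,p_1,\dots,p_{k+l}$ from $1$ to $n$ is understood.
   Context: $S^m=S^m\mathbb R^n$ is the complex vector space of symmetric $m$-tensors on $\mathbb R^n$ (components in an orthonormal basis; upper and lower indices are not distinguished; repeated indices are summed from $1$ to $n$). $\mathcal S(\mathbb R^n;S^m)$ is the space of symmetric $m$-tensor fields with Schwartz components. For $x\in\mathbb R^n$, $x^{r}\in S^{r}$ denotes the symmetric power, $(x^{r})_{p_1\dots p_{r}}=x_{p_1}\cdots x_{p_{r}}$. The symmetric product $x^{k+l}f$ is the symmetric $(m+k+l)$-tensor field with components $$(x^{k+l}f)^{j_1\dots j_mp_1\dots p_{k+l}}=\sigma(j_1\dots j_mp_1\dots p_{k+l})\big(x^{p_1}\cdots x^{p_{k+l}}f^{j_1\dots j_m}(x)\big),$$ where $\sigma$ denotes symmetrization (averaging over all permutations) in the listed indices. Let $T\mathbb S^{n-1}=\{(x,\xi)\in\mathbb R^n\times\mathbb S^{n-1}:\langle x,\xi\rangle=0\}$. The momentum ray transform $I_m^k:\mathcal S(\mathbb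 R^n;S^m)\to\mathcal S(T\mathbb S^{n-1})$ is $$I_m^kf(x,\xi)=\int_{-\infty}^\infty t^k f_{i_1\dots i_m}(x+t\xi)\,\xi^{i_1}\cdots\xi^{i_m}\,dt,$$ its formal $L^2$-adjoint is $$\big((I_m^k)^*\varphi\big)_{i_1\dots i_m}(x)=\int_{\mathbb S^{n-1}}\langle x,\xi\rangle^k\,\xi_{i_1}\cdots\xi_{i_m}\,\varphi\big(x-\langle x,\xi\rangle\xi,\xi\big)\,d\xi$$ ($d\xi$ the standard surface measure on $\mathbb S^{n-1}$), and the normal operator is $N_m^k=(I_m^k)^*I_m^k:\mathcal S(\mathbb R^n;S^m)\to C^\infty(\mathbb R^n;S^m)$. *)

theory Defs
  imports "HOL-Analysis.Analysis" "HOL-Combinatorics.Permutations"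
begin

text \<open>
  A tensor of rank \<open>m\<close> on \<open>real^'n\<close> is given by its components with respect to the standard
  basis, indexed by lists of indices. The rank is not part of the type: only the components at
  lists of length \<open>m\<close> are meaningful, all other values are junk.
\<close>

type_synonym 'n tensor = "'n list \<Rightarrow> complex"
type_synonym 'n tensor_field = "real^'n \<Rightarrow> 'n tensor"

definition sym_tensor :: "nat \<Rightarrow> 'n tensor \<Rightarrow> bool" where
  "sym_tensor m T \<longleftrightarrow>
     (\<forall>is \<pi>. length is = m \<longrightarrow> \<pi> permutes {..<m} \<longrightarrow> T (permute_list \<pi> is) = T is)"

definition symmetrize :: "'n tensor \<Rightarrow> 'n tensor" where
  "symmetrize T is =
     (\<Sum>\<pi> | \<pi> permutes {..<length is}. T (permute_list \<pi> is)) / fact (length is)"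

text \<open>The first factor has rank \<open>m\<close>; the rank of the second is the number of remaining indices.\<close>

definition sym_prod :: "nat \<Rightarrow> 'n tensor \<Rightarrow> 'n tensor \<Rightarrow> 'n tensor" where
  "sym_prod m T S = symmetrize (\<lambda>is. T (take m is) * S (drop m is))"

text \<open>The symmetric power \<open>x\<^sup>r\<close>, simultaneously for all ranks \<open>r\<close>: the rank is the length of the
  index list.\<close>

definition tensor_pow :: "real^'n \<Rightarrow> 'n tensor" where
  "tensor_pow x is = of_real (\<Prod>i\<leftarrow>is. x $ i)"

text \<open>Iterated partial derivatives; differentiability of all of them amounts to smoothness.\<close>

primrec iter_partial :: "'n list \<Rightarrow> (real^'n \<Rightarrow> complex) \<Rightarrow> real^('n::finite) \<Rightarrow> complex" where
  "iter_partial [] g = g"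
| "iter_partial (i # is) g = (\<lambda>x. frechet_derivative (iter_partial is g) (at x) (axis i 1))"

definition schwartz :: "(real^('n::finite) \<Rightarrow> complex) set" where
  "schwartz = {g. \<forall>is. (\<forall>x. iter_partial is g differentiable (at x)) \<and>
                    (\<forall>N::nat. bounded (range (\<lambda>x. norm x ^ N *\<^sub>R iter_partial is g x)))}"

definition schwartz_sym_fields :: "nat \<Rightarrow> ('n::finite) tensor_field set" where
  "schwartz_sym_fields m =
     {f. (\<forall>x. sym_tensor m (f x)) \<and> (\<forall>is. length is = m \<longrightarrow> (\<lambda>x. f x is) \<in> schwartz)}"

text \<open>
  The surface measure on the unit sphere, defined as the cone measure: \<open>A\<close> has measure \<open>n\<close> times
  the volume of the cone \<open>{r \<xi> | 0 < r \<le> 1, \<xi> \<in> A}\<close> (see \<open>emeasure_sphere_measure\<close>). This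
  is the measure for which integration in polar coordinates reads \<open>dx = r\<^bsup>n-1\<^esup> dr d\<xi>\<close>.
\<close>

definition sphere_measure :: "(real^('n::finite)) measure" where
  "sphere_measure =
     scale_measure (of_nat CARD('n))
       (distr (restrict_space lborel (cball 0 1 - {0})) (restrict_space borel (sphere 0 1)) sgn)"

lemma space_sphere_measure [simp]: "space sphere_measure = sphere 0 1"
  by (simp add: sphere_measure_def space_scale_measure space_restrict_space)

lemma sets_sphere_measure: "sets sphere_measure = sets (restrict_space borel (sphere 0 1))"
  by (simp add: sphere_measure_def)

lemma emeasure_sphere_measure:
  fixes A :: "(real^('n::finite)) set"
  assumes "A \<in> sets borel" "A \<subseteq> sphere 0 1"
  shows "emeasure sphere_measure A =
           of_nat CARD('n) * emeasure lborel {r *\<^sub>R \<xi> | r \<xi>. 0 < r \<and> r \<le> 1 \<and> \<xi> \<in> A}"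
proof -
  let ?B = "cball 0 1 - {0} :: (real^'n) set"
  have B: "?B \<in> sets borel" by auto
  have A: "A \<in> sets (restrict_space borel (sphere 0 1))"
    using assms by (auto simp: sets_restrict_space_iff)
  have meas: "sgn \<in> measurable (restrict_space lborel ?B) (restrict_space borel (sphere 0 1 :: (real^'n) set))"
  proof (rule measurable_restrict_space2)
    show "sgn \<in> space (restrict_space lborel ?B) \<rightarrow> (sphere 0 1 :: (real^'n) set)"
      by (auto simp: space_restrict_space norm_sgn)
    have "(\<lambda>x::real^'n. x /\<^sub>R norm x) \<in> borel_measurable borel" by measurable
    then have "(sgn :: real^'n \<Rightarrow> _) \<in> borel_measurable lborel"
      by (simp add: sgn_div_norm[abs_def])
    then show "sgn \<in> borel_measurable (restrict_space lborel ?B)"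
      by (rule measurable_restrict_space1)
  qed
  have eq: "sgn -` A \<inter> ?B = {r *\<^sub>R \<xi> | r \<xi>. 0 < r \<and> r \<le> 1 \<and> \<xi> \<in> A}" (is "?L = ?R")
  proof
    show "?L \<subseteq> ?R"
    proof
      fix x assume x: "x \<in> ?L"
      then have "x = norm x *\<^sub>R sgn x" by (simp add: sgn_div_norm)
      with x show "x \<in> ?R" by (intro CollectI exI[of _ "norm x"] exI[of _ "sgn x"]) auto
    qed
    show "?R \<subseteq> ?L"
    proof
      fix x assume "x \<in> ?R"
      then obtain r \<xi> where *: "x = r *\<^sub>R \<xi>" "0 < r" "r \<le> 1" "\<xi> \<in> A" by auto
      with assms(2) have "norm \<xi> = 1" by auto
      with * show "x \<in> ?L" by (auto simp: sgn_div_norm)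
    qed
  qed
  have "emeasure (restrict_space lborel ?B) (sgn -` A \<inter> ?B) = emeasure lborel (sgn -` A \<inter> ?B)"
    using B by (intro emeasure_restrict_space) auto
  then show ?thesis
    unfolding sphere_measure_def
    by (simp add: emeasure_scale_measure emeasure_distr[OF meas A] space_restrict_space eq)
qed

text \<open>
  Functions on \<open>TS\<^bsup>n-1\<^esup> = {(x, \<xi>). norm \<xi> = 1 \<and> x \<bullet> \<xi> = 0}\<close> are represented by functions on all pairs;
  \<open>ray_adjoint\<close> evaluates them at points of this set only.
\<close>

definition ray_transform ::
  "nat \<Rightarrow> nat \<Rightarrow> ('n::finite) tensor_field \<Rightarrow> (real^'n) \<times> (real^'n) \<Rightarrow> complex" where
  "ray_transform m k f = (\<lambda>(x, \<xi>).
     LINT t|lborel. of_real (t ^ k) * (\<Sum>is | length is = m. f (x + t *\<^sub>R \<xi>) is * tensor_pow \<xi> is))"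

definition ray_adjoint ::
  "nat \<Rightarrow> ((real^'n) \<times> (real^'n) \<Rightarrow> complex) \<Rightarrow> ('n::finite) tensor_field" where
  "ray_adjoint k \<phi> x is =
     (LINT \<xi>|sphere_measure.
        of_real ((x \<bullet> \<xi>) ^ k) * tensor_pow \<xi> is * \<phi> (x - (x \<bullet> \<xi>) *\<^sub>R \<xi>, \<xi>))"

definition normal_op :: "nat \<Rightarrow> nat \<Rightarrow> ('n::finite) tensor_field \<Rightarrow> 'n tensor_field" where
  "normal_op m k f = ray_adjoint k (ray_transform m k f)"

definition convolution ::
  "(real^('n::finite) \<Rightarrow> complex) \<Rightarrow> (real^'n \<Rightarrow> complex) \<Rightarrow> real^'n \<Rightarrow> complex" where
  "convolution g h x = (LINT y|lborel. g y * h (x - y))"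

end

(*
  Substituting t = s + <x,xi> in the ray integral turns N f(x) into the integral over the sphere
  and over s in R of <x,xi>^k (s + <x,xi>)^k xi_I <f(x + s xi), xi^m>. Integrating over whole lines
  instead of half-lines covers R^n twice, which gives the factor 2 and the kernel |z|^(1-n) with
  z = s xi. With y = x + z one has <x,z> = <y,z> - |z|^2, and the binomial expansion of <x,z>^k
  produces the sum over l; the powers of <y,z> are the contractions of y^(k+l) with z^(k+l), where
  the symmetrization is absorbed by the symmetric tensor z^(m+k+l).
*)
theory Submission
  imports Defs
begin

subsection \<open>Polar coordinates along lines through the origin\<close>

text \<open>The obstacle is absolute convergence: Fubini and the exchange of sums and integrals
  require integrability in advance. The kernel with index \<open>l\<close> is homogeneous of degree
  (2m+k+l) - (2m+2l+n-1) = (k-l) - (n-1). As l \<le> k, its singularity at the origin is never worse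
  than that of |z|^(1-n), and the growth by at most |z|^(k-l) is absorbed by the rapid decay of
  \<open>f\<close>. Hence every single convolution integral is dominated by a multiple of |z|^(1-n)
  / (1+|z|^2). Integrability of the whole density is deduced from these terms and carried back to
  sphere times line by an equality of measures, so that no estimate along individual rays occurs.
  Lines can replace half-lines because the powers of \<open>s\<close> that homogeneity produces,
  s^(2m+2k), are even: the points \<open>s\<close> and \<open>-s\<close> need no separate
  treatment.\<close>

lemma borel_measurable_sgn_vector [measurable]: "(sgn :: 'a::euclidean_space \<Rightarrow> 'a) \<in> borel_measurable borel"
proof -
  have "(\<lambda>x::'a. x /\<^sub>R norm x) \<in> borel_measurable borel" by measurable
  then show ?thesis by (simp add: sgn_div_norm[abs_def])
qed

lemma nn_integral_lborel_scale:
  fixes f :: "'a::euclidean_space \<Rightarrow> ennreal"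
  assumes [measurable]: "f \<in> borel_measurable borel" and "c \<noteq> 0"
  shows "(\<integral>\<^sup>+x. f x \<partial>lborel) = ennreal (\<bar>c\<bar> ^ DIM('a)) * (\<integral>\<^sup>+x. f (c *\<^sub>R x) \<partial>lborel)"
  by (subst lborel_affine[OF assms(2), of 0])
     (simp add: nn_integral_density nn_integral_distr nn_integral_cmult)

text \<open>The antiderivative is \<open>- 1 / (n * s ^ n)\<close> on the half-line
  \<open>s \<ge> a\<close>, and reflection doubles the value; \<open>a > 0\<close> keeps the two
  half-lines disjoint. The polar formula uses it with \<open>n\<close> the dimension and
  \<open>a = norm w\<close>, which is where the factor 2 of the theorem arises.\<close>

lemma nn_integral_abs_power_tail:
  assumes "0 < a" "0 < n"
  shows "(\<integral>\<^sup>+s. ennreal (if a \<le> \<bar>s\<bar> then 1 / \<bar>s\<bar> ^ Suc n else 0) \<partial>lborel) = ennreal (2 / (real n * a ^ n))"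
proof -
  define g where "g = (\<lambda>s::real. ennreal (1 / s ^ Suc n) * indicator {a..} s)"
  have g [measurable]: "g \<in> borel_measurable borel" unfolding g_def by measurable
  have lim: "((\<lambda>s. - 1 / (real n * s ^ n)) \<longlongrightarrow> 0) at_top"
    using assms(2)
    by (intro tendsto_divide_0 tendsto_const filterlim_at_top_imp_at_infinity
          filterlim_tendsto_pos_mult_at_top[OF tendsto_const] filterlim_pow_at_top filterlim_ident) auto
  have "(\<integral>\<^sup>+s. g s \<partial>lborel) = ennreal (0 - - 1 / (real n * a ^ n))"
    unfolding g_def
  proof (rule nn_integral_FTC_atLeast[OF _ _ _ lim])
    fix s assume "a \<le> s"
    then have "s > 0" using assms by simp
    then show "DERIV (\<lambda>s. - 1 / (real n * s ^ n)) s :> 1 / s ^ Suc n"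
      using assms(2) by (auto intro!: derivative_eq_intros simp: field_simps)
         (cases n; simp add: field_simps)
    show "0 \<le> 1 / s ^ Suc n" using \<open>s > 0\<close> by simp
  qed measurable
  then have *: "(\<integral>\<^sup>+s. g s \<partial>lborel) = ennreal (1 / (real n * a ^ n))" by simp
  have "(\<integral>\<^sup>+s. g (- s) \<partial>lborel) = (\<integral>\<^sup>+s. g s \<partial>lborel)"
    using nn_integral_real_affine[of g "-1" 0] by simp
  moreover have "ennreal (if a \<le> \<bar>s\<bar> then 1 / \<bar>s\<bar> ^ Suc n else 0) = g s + g (- s)" for s
    using assms by (auto simp: g_def abs_if indicator_def)
  ultimately show ?thesis
    using assms * by (simp add: nn_integral_add ennreal_plus[symmetric] del: ennreal_plus)
qed

section \<open>Integration against the cone measure on the sphere\<close>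

lemma measurable_sphere_measure:
  "f \<in> borel_measurable borel \<Longrightarrow> f \<in> borel_measurable sphere_measure"
  by (simp add: measurable_restrict_space1 measurable_cong_sets[OF sets_sphere_measure refl])

lemma measurable_sgn_sphere:
  "(sgn :: real^'n::finite \<Rightarrow> _) \<in>
     measurable (restrict_space lborel (cball 0 1 - {0})) (restrict_space borel (sphere 0 1))"
proof (rule measurable_restrict_space2)
  show "(sgn :: real^'n \<Rightarrow> _) \<in> space (restrict_space lborel (cball 0 1 - {0})) \<rightarrow> sphere 0 1"
    by (auto simp: space_restrict_space norm_sgn)
  show "(sgn :: real^'n \<Rightarrow> _) \<in> borel_measurable (restrict_space lborel (cball 0 1 - {0}))"
    by (rule measurable_restrict_space1) simp
qed

text \<open>Here \<open>sgn\<close> is the radial projection of the punctured ball onto the sphere.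
  Total mass and polar coordinates are both reduced to Lebesgue measure through this
  formula.\<close>

lemma nn_integral_sphere_measure:
  fixes F :: "real^'n::finite \<Rightarrow> ennreal"
  assumes "F \<in> borel_measurable borel"
  shows "(\<integral>\<^sup>+\<xi>. F \<xi> \<partial>sphere_measure) =
    of_nat CARD('n) * (\<integral>\<^sup>+z. F (sgn z) * indicator (cball 0 1 - {0}) z \<partial>lborel)"
proof -
  have F: "F \<in> borel_measurable (restrict_space borel (sphere 0 1))"
    using assms by (rule measurable_restrict_space1)
  have B: "cball 0 1 - {0::real^'n} \<in> sets borel" by simp
  have "(\<integral>\<^sup>+\<xi>. F \<xi> \<partial>sphere_measure) = of_nat CARD('n) *
      (\<integral>\<^sup>+\<xi>. F \<xi> \<partial>distr (restrict_space lborel (cball 0 1 - {0})) (restrict_space borel (sphere 0 1)) sgn)"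
    unfolding sphere_measure_def by (rule nn_integral_scale_measure) (simp add: F)
  also have "\<dots> = of_nat CARD('n) * (\<integral>\<^sup>+z. F (sgn z) \<partial>restrict_space lborel (cball 0 1 - {0}))"
    by (simp only: nn_integral_distr[OF measurable_sgn_sphere] measurable_distr_eq1 F)
  also have "\<dots> = of_nat CARD('n) * (\<integral>\<^sup>+z. F (sgn z) * indicator (cball 0 1 - {0}) z \<partial>lborel)"
    by (subst nn_integral_restrict_space) (simp_all only: space_lborel space_borel sets_lborel Int_UNIV_right B)
  finally show ?thesis .
qed

text \<open>The cone over the whole sphere is the punctured unit ball, which has finite volume.
  Finiteness makes the product with the line sigma-finite, as Fubini requires, and bounds the
  angular part of the dominating weight.\<close>

lemma finite_measure_sphere_measure: "finite_measure (sphere_measure :: (real^'n::finite) measure)"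
proof
  let ?S = "sphere_measure :: (real^'n) measure"
  have "emeasure ?S (space ?S) = (\<integral>\<^sup>+\<xi>. 1 \<partial>?S)"
    by simp
  also have "\<dots> = of_nat CARD('n) * (\<integral>\<^sup>+z. indicator (cball 0 1 - {0}) z \<partial>(lborel :: (real^'n) measure))"
    by (subst nn_integral_sphere_measure) simp_all
  also have "\<dots> = of_nat CARD('n) * emeasure lborel (cball 0 1 - {0} :: (real^'n) set)"
    by (subst nn_integral_indicator) simp_all
  also have "emeasure lborel (cball 0 1 - {0} :: (real^'n) set) \<le> emeasure lborel (cball 0 1 :: (real^'n) set)"
    by (rule emeasure_mono) auto
  also have "of_nat CARD('n) * emeasure lborel (cball 0 1 :: (real^'n) set) < \<infinity>"
    using emeasure_lborel_cball_finite[of "0::real^'n" 1]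
    by (simp add: ennreal_mult_less_top of_nat_less_top)
  finally show "emeasure ?S (space ?S) \<noteq> \<infinity>" by (simp add: mult_left_mono)
qed

text \<open>The sphere measure is defined through the unit ball, so after the substitution
  \<open>s \<mapsto> s * norm z\<close> and \<open>w = s z\<close> each point \<open>w\<close> gets the weight
  \<open>2 / n\<close>, the integral of \<open>norm w ^ n / \<bar>s\<bar> ^ (n + 1)\<close> over \<open>norm w \<le> \<bar>s\<bar>\<close>.\<close>

lemma nn_integral_line_polar:
  fixes h :: "real^'n::finite \<Rightarrow> ennreal"
  assumes [measurable]: "h \<in> borel_measurable borel"
  shows "(\<integral>\<^sup>+\<xi>. \<integral>\<^sup>+s. ennreal (\<bar>s\<bar> ^ (CARD('n) - 1)) * h (s *\<^sub>R \<xi>) \<partial>lborel \<partial>sphere_measure) =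
    2 * (\<integral>\<^sup>+z. h z \<partial>lborel)"
proof -
  let ?B = "cball 0 1 - {0} :: (real^'n) set"
  define N where "N = CARD('n) - 1"
  have N: "CARD('n) = Suc N" unfolding N_def using zero_less_card_finite[where 'a='n] by linarith
  have [measurable]: "Measurable.pred (borel :: (real^'n) measure) (\<lambda>z. z \<in> ?B)"
    by (simp add: pred_def)
  have "(\<integral>\<^sup>+\<xi>. \<integral>\<^sup>+s. ennreal (\<bar>s\<bar> ^ N) * h (s *\<^sub>R \<xi>) \<partial>lborel \<partial>sphere_measure) =
    of_nat CARD('n) * (\<integral>\<^sup>+z. (\<integral>\<^sup>+s. ennreal (\<bar>s\<bar> ^ N) * h (s *\<^sub>R sgn z) \<partial>lborel) * indicator ?B z \<partial>lborel)"
    by (rule nn_integral_sphere_measure) measurable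
  also have "(\<integral>\<^sup>+z. (\<integral>\<^sup>+s. ennreal (\<bar>s\<bar> ^ N) * h (s *\<^sub>R sgn z) \<partial>lborel) * indicator ?B z \<partial>lborel) =
     (\<integral>\<^sup>+z. \<integral>\<^sup>+s. ennreal (if z \<in> ?B then \<bar>s\<bar> ^ N * norm z ^ Suc N else 0) * h (s *\<^sub>R z) \<partial>lborel \<partial>lborel)"
  proof (intro nn_integral_cong)
    fix z :: "real^'n"
    show "(\<integral>\<^sup>+s. ennreal (\<bar>s\<bar> ^ N) * h (s *\<^sub>R sgn z) \<partial>lborel) * indicator ?B z =
      (\<integral>\<^sup>+s. ennreal (if z \<in> ?B then \<bar>s\<bar> ^ N * norm z ^ Suc N else 0) * h (s *\<^sub>R z) \<partial>lborel)"
    proof (cases "z \<in> ?B")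
      case True
      then have z: "norm z \<noteq> 0" by auto
      have "(norm z * s) *\<^sub>R sgn z = s *\<^sub>R z" for s
        using z by (simp add: sgn_div_norm)
      then have "(\<integral>\<^sup>+s. ennreal (\<bar>s\<bar> ^ N) * h (s *\<^sub>R sgn z) \<partial>lborel) =
          ennreal (norm z) * (\<integral>\<^sup>+s. ennreal (\<bar>norm z * s\<bar> ^ N) * h (s *\<^sub>R z) \<partial>lborel)"
        by (subst nn_integral_real_affine[OF _ z, of _ 0]) simp_all
      also have "\<dots> = (\<integral>\<^sup>+s. ennreal (norm z) * (ennreal (\<bar>norm z * s\<bar> ^ N) * h (s *\<^sub>R z)) \<partial>lborel)"
        by (rule nn_integral_cmult[symmetric]) measurable
      also have "\<dots> = (\<integral>\<^sup>+s. ennreal (\<bar>s\<bar> ^ N * norm z ^ Suc N) * h (s *\<^sub>R z) \<partial>lborel)"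
        by (intro nn_integral_cong)
           (simp only: mult.assoc[symmetric] ennreal_mult'[symmetric] norm_ge_zero,
            simp add: abs_mult power_mult_distrib ac_simps)
      finally show ?thesis using True by simp
    next
      case False
      then show ?thesis
        unfolding if_not_P[OF False] indicator_simps(2)[OF False] by simp
    qed
  qed
  also have "\<dots> = (\<integral>\<^sup>+s. \<integral>\<^sup>+z. ennreal (if z \<in> ?B then \<bar>s\<bar> ^ N * norm z ^ Suc N else 0) * h (s *\<^sub>R z) \<partial>lborel \<partial>lborel)"
    by (rule lborel_pair.Fubini') measurable
  \<comment> \<open>Exponent count for \<open>w = s z\<close>: besides \<open>|s| ^ N\<close>, the
    Jacobian gives |s|^-(N+1), and \<open>norm z ^ Suc N\<close> gives another |s|^-(N+1) next to
    \<open>norm w ^ Suc N\<close>, in total |s|^-(N+2). The ball condition turns into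
    \<open>norm w \<le> |s|\<close>. The substitution excludes the null set
    \<open>s = 0\<close>.\<close>
  also have "\<dots> = (\<integral>\<^sup>+s. \<integral>\<^sup>+w. ennreal (if norm w \<le> \<bar>s\<bar> \<and> w \<noteq> 0 then 1 / \<bar>s\<bar> ^ Suc (Suc N) * norm w ^ Suc N else 0) * h w \<partial>lborel \<partial>lborel)"
  proof (intro nn_integral_cong_AE)
    have "AE s in lborel. s \<noteq> (0::real)" by (rule AE_lborel_singleton)
    then show "AE s in lborel. (\<integral>\<^sup>+z. ennreal (if z \<in> ?B then \<bar>s\<bar> ^ N * norm z ^ Suc N else 0) * h (s *\<^sub>R z) \<partial>lborel) =
      (\<integral>\<^sup>+w. ennreal (if norm w \<le> \<bar>s\<bar> \<and> w \<noteq> 0 then 1 / \<bar>s\<bar> ^ Suc (Suc N) * norm w ^ Suc N else 0) * h w \<partial>lborel)"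
    proof eventually_elim
      case (elim s)
      then have c: "1 / s \<noteq> 0" by simp
      show ?case
      proof (subst nn_integral_lborel_scale[OF _ c], measurable, subst nn_integral_cmult[symmetric], measurable, rule nn_integral_cong)
        fix w :: "real^'n"
        have "ennreal (\<bar>1 / s\<bar> ^ DIM(real^'n)) * (ennreal (if (1 / s) *\<^sub>R w \<in> ?B then \<bar>s\<bar> ^ N * norm ((1 / s) *\<^sub>R w) ^ Suc N else 0))
           = ennreal (if norm w \<le> \<bar>s\<bar> \<and> w \<noteq> 0 then 1 / \<bar>s\<bar> ^ Suc (Suc N) * norm w ^ Suc N else 0)"
          using elim by (auto simp: N ennreal_mult[symmetric] field_simps power_divide)
        then show "ennreal (\<bar>1 / s\<bar> ^ DIM(real^'n)) * (ennreal (if (1 / s) *\<^sub>R w \<in> ?B then \<bar>s\<bar> ^ N * norm ((1 / s) *\<^sub>R w) ^ Suc N else 0) * h (s *\<^sub>R (1 / s) *\<^sub>R w))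
           = ennreal (if norm w \<le> \<bar>s\<bar> \<and> w \<noteq> 0 then 1 / \<bar>s\<bar> ^ Suc (Suc N) * norm w ^ Suc N else 0) * h w"
          using elim by (simp add: mult.assoc[symmetric])
      qed
    qed
  qed
  also have "\<dots> = (\<integral>\<^sup>+w. \<integral>\<^sup>+s. ennreal (if norm w \<le> \<bar>s\<bar> \<and> w \<noteq> 0 then 1 / \<bar>s\<bar> ^ Suc (Suc N) * norm w ^ Suc N else 0) * h w \<partial>lborel \<partial>lborel)"
    by (rule lborel_pair.Fubini'[symmetric]) measurable
  also have "\<dots> = (\<integral>\<^sup>+w. ennreal (2 / real CARD('n)) * h w \<partial>lborel)"
  proof (intro nn_integral_cong_AE)
    have "AE w in lborel. w \<noteq> (0::real^'n)" by (rule AE_lborel_singleton)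
    then show "AE w in lborel. (\<integral>\<^sup>+s. ennreal (if norm w \<le> \<bar>s\<bar> \<and> w \<noteq> 0 then 1 / \<bar>s\<bar> ^ Suc (Suc N) * norm w ^ Suc N else 0) * h w \<partial>lborel)
       = ennreal (2 / real CARD('n)) * h w"
    proof eventually_elim
      case (elim w)
      then have w: "norm w > 0" by simp
      have "(\<integral>\<^sup>+s. ennreal (if norm w \<le> \<bar>s\<bar> \<and> w \<noteq> 0 then 1 / \<bar>s\<bar> ^ Suc (Suc N) * norm w ^ Suc N else 0) * h w \<partial>lborel)
        = (\<integral>\<^sup>+s. (ennreal (norm w ^ Suc N) * h w) * ennreal (if norm w \<le> \<bar>s\<bar> then 1 / \<bar>s\<bar> ^ Suc (Suc N) else 0) \<partial>lborel)"
        by (intro nn_integral_cong) (simp add: elim ennreal_mult'[symmetric] mult_ac del: power_Suc)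
      also have "\<dots> = (ennreal (norm w ^ Suc N) * h w) * ennreal (2 / (real (Suc N) * norm w ^ Suc N))"
        by (subst nn_integral_cmult, measurable, subst nn_integral_abs_power_tail[OF w]) simp_all
      also have "\<dots> = ennreal (norm w ^ Suc N * (2 / (real (Suc N) * norm w ^ Suc N))) * h w"
        using w by (subst ennreal_mult') (simp_all add: mult_ac del: power_Suc of_nat_Suc)
      also have "norm w ^ Suc N * (2 / (real (Suc N) * norm w ^ Suc N)) = 2 / real CARD('n)"
        using w by (simp add: N del: power_Suc of_nat_Suc)
      finally show ?case .
    qed
  qed
  \<comment> \<open>The dimension that normalizes the cone measure cancels the denominator of the
    weight, and only the 2 from the two half-lines is left.\<close>
  also have "of_nat CARD('n) * \<dots> = ennreal (real CARD('n) * (2 / real CARD('n))) * (\<integral>\<^sup>+w. h w \<partial>lborel)"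
    by (subst nn_integral_cmult, measurable)
       (simp only: ennreal_mult'[OF of_nat_0_le_iff] ennreal_of_nat_eq_real_of_nat mult.assoc)
  finally show ?thesis by (simp add: N_def)
qed

lemma measurable_line_sphere [measurable]:
  "(\<lambda>p. snd p *\<^sub>R fst p) \<in> borel_measurable (sphere_measure \<Otimes>\<^sub>M lborel :: ((real^'n::finite) \<times> real) measure)"
proof -
  have [measurable]: "fst \<in> borel_measurable (sphere_measure \<Otimes>\<^sub>M lborel :: ((real^'n) \<times> real) measure)"
    by (rule measurable_compose[OF measurable_fst measurable_sphere_measure]) simp
  show ?thesis by measurable
qed

text \<open>Stating polar coordinates as an equality of measures lets the general rules for image
  measures and densities transfer both integrability and the value of Bochner integrals, without
  approximating the integrand.\<close>

lemma distr_line_polar: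
  "distr (density (sphere_measure \<Otimes>\<^sub>M lborel) (\<lambda>p. ennreal (\<bar>snd p\<bar> ^ (CARD('n) - 1)))) borel
     (\<lambda>p. snd p *\<^sub>R fst p) = density (lborel :: (real^'n::finite) measure) (\<lambda>_. ennreal 2)"
proof (rule measure_eqI)
  fix A :: "(real^'n) set"
  assume "A \<in> sets (distr (density (sphere_measure \<Otimes>\<^sub>M lborel) (\<lambda>p. ennreal (\<bar>snd p\<bar> ^ (CARD('n) - 1)))) borel
     (\<lambda>p. snd p *\<^sub>R fst p))"
  then have A [measurable]: "A \<in> sets borel" by simp
  let ?w = "\<lambda>p::(real^'n) \<times> real. ennreal (\<bar>snd p\<bar> ^ (CARD('n) - 1))"
  let ?M = "sphere_measure \<Otimes>\<^sub>M lborel :: ((real^'n) \<times> real) measure"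
  have T: "(\<lambda>p. snd p *\<^sub>R fst p) \<in> measurable (density ?M ?w) borel"
    by (simp add: measurable_line_sphere)
  have iA: "(\<lambda>p. indicator A (snd p *\<^sub>R fst p) :: ennreal) \<in> borel_measurable ?M"
    by (rule measurable_compose[OF measurable_line_sphere]) measurable
  have w: "?w \<in> borel_measurable ?M" by measurable
  have wA: "(\<lambda>p. ?w p * indicator A (snd p *\<^sub>R fst p)) \<in> borel_measurable ?M"
    using w iA by (rule borel_measurable_times_ennreal)
  have "emeasure (distr (density ?M ?w) borel (\<lambda>p. snd p *\<^sub>R fst p)) A =
      (\<integral>\<^sup>+z. indicator A z \<partial>distr (density ?M ?w) borel (\<lambda>p. snd p *\<^sub>R fst p))"
    by (rule nn_integral_indicator[symmetric]) simp
  also have "\<dots> = (\<integral>\<^sup>+p. indicator A (snd p *\<^sub>R fst p) \<partial>density ?M ?w)"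
    by (rule nn_integral_distr[OF T]) (simp only: measurable_distr_eq1 borel_measurable_indicator A)
  also have "\<dots> = (\<integral>\<^sup>+p. ?w p * indicator A (snd p *\<^sub>R fst p) \<partial>?M)"
    by (rule nn_integral_density[OF w iA])
  also have "\<dots> = (\<integral>\<^sup>+\<xi>. \<integral>\<^sup>+s. ennreal (\<bar>s\<bar> ^ (CARD('n) - 1)) * indicator A (s *\<^sub>R \<xi>) \<partial>lborel \<partial>sphere_measure)"
    by (subst lborel.nn_integral_fst[symmetric]) (use wA in simp_all)
  also have "\<dots> = 2 * (\<integral>\<^sup>+z. indicator A z \<partial>lborel)"
    by (rule nn_integral_line_polar) measurable
  also have "\<dots> = emeasure (density (lborel :: (real^'n) measure) (\<lambda>_. ennreal 2)) A"
    by (simp add: emeasure_density nn_integral_cmult)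
  finally show "emeasure (distr (density ?M ?w) borel (\<lambda>p. snd p *\<^sub>R fst p)) A =
    emeasure (density (lborel :: (real^'n) measure) (\<lambda>_. ennreal 2)) A" .
qed simp

lemma integral_line_polar:
  fixes G :: "real^'n::finite \<Rightarrow> 'b::{banach, second_countable_topology}"
  assumes G: "integrable lborel G"
  shows "(LINT \<xi>|sphere_measure. LINT s|lborel. \<bar>s\<bar> ^ (CARD('n) - 1) *\<^sub>R G (s *\<^sub>R \<xi>)) =
    2 *\<^sub>R (LINT z|lborel. G z)"
proof -
  interpret finite_measure "sphere_measure :: (real^'n) measure"
    by (rule finite_measure_sphere_measure)
  interpret P: pair_sigma_finite "sphere_measure :: (real^'n) measure" "lborel :: real measure" ..
  let ?w = "\<lambda>p::(real^'n) \<times> real. \<bar>snd p\<bar> ^ (CARD('n) - 1)"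
  let ?M = "sphere_measure \<Otimes>\<^sub>M lborel :: ((real^'n) \<times> real) measure"
  have G1: "G \<in> borel_measurable borel" using borel_measurable_integrable[OF G] by simp
  have T: "(\<lambda>p. snd p *\<^sub>R fst p) \<in> measurable (density ?M ?w) borel"
    by (simp add: measurable_line_sphere)
  have GT: "(\<lambda>p. G (snd p *\<^sub>R fst p)) \<in> borel_measurable ?M"
    by (rule measurable_compose[OF measurable_line_sphere G1])
  have w: "?w \<in> borel_measurable ?M" by measurable
  have nn: "AE p in ?M. 0 \<le> ?w p" by simp
  \<comment> \<open>The equality of measures is read from space to sphere times line: integrability
    of \<open>G\<close> becomes integrability on the product, the hypothesis of Fubini
    below.\<close>
  have "integrable (density (lborel :: (real^'n) measure) (\<lambda>_. ennreal 2)) G"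
    using G G1 by (subst integrable_density) auto
  then have "integrable (density ?M ?w) (\<lambda>p. G (snd p *\<^sub>R fst p))"
    unfolding distr_line_polar[symmetric] by (subst (asm) integrable_distr_eq[OF T G1])
  then have int: "integrable ?M (\<lambda>p. ?w p *\<^sub>R G (snd p *\<^sub>R fst p))"
    by (simp only: integrable_density[OF GT w nn])
  have "(LINT \<xi>|sphere_measure. LINT s|lborel. \<bar>s\<bar> ^ (CARD('n) - 1) *\<^sub>R G (s *\<^sub>R \<xi>)) =
      (LINT p|?M. ?w p *\<^sub>R G (snd p *\<^sub>R fst p))"
    using P.integral_fst'[OF int] by simp
  also have "\<dots> = (LINT p|density ?M ?w. G (snd p *\<^sub>R fst p))"
    by (rule integral_density[OF GT w nn, symmetric])
  also have "\<dots> = (LINT z|distr (density ?M ?w) borel (\<lambda>p. snd p *\<^sub>R fst p). G z)"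
    by (rule integral_distr[OF T G1, symmetric])
  also have "\<dots> = 2 *\<^sub>R (LINT z|lborel. G z)"
    unfolding distr_line_polar using G1 by (subst integral_density) auto
  finally show ?thesis .
qed

section \<open>Integrability of the dominating weight\<close>

lemma nn_integral_inverse_1_plus_square_finite:
  "(\<integral>\<^sup>+s. ennreal (1 / (1 + s\<^sup>2)) \<partial>lborel) < \<infinity>"
proof -
  have "(\<integral>\<^sup>+s. ennreal (1 / (1 + s\<^sup>2)) \<partial>lborel) \<le>
      (\<integral>\<^sup>+s. indicator {-1..1} s + ennreal (if 1 \<le> \<bar>s\<bar> then 1 / \<bar>s\<bar> ^ Suc 1 else 0) \<partial>lborel)"
  proof (rule nn_integral_mono)
    fix s :: real
    have "1 / (1 + s\<^sup>2) \<le> 1" by (subst divide_le_eq_1_pos) (simp_all add: add_pos_nonneg)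
    moreover have "1 / (1 + s\<^sup>2) \<le> 1 / \<bar>s\<bar> ^ Suc 1" if "1 \<le> \<bar>s\<bar>"
      using that by (intro divide_left_mono) (auto simp: power2_eq_square[symmetric] intro!: mult_pos_pos add_pos_nonneg)
    ultimately show "ennreal (1 / (1 + s\<^sup>2)) \<le>
        indicator {-1..1} s + ennreal (if 1 \<le> \<bar>s\<bar> then 1 / \<bar>s\<bar> ^ Suc 1 else 0)"
      by (cases "1 \<le> \<bar>s\<bar>") (auto simp: indicator_def intro!: ennreal_leI add_increasing)
  qed
  also have "\<dots> = 2 + ennreal (2 / (real 1 * 1 ^ 1))"
    by (subst nn_integral_add, measurable, subst nn_integral_abs_power_tail) simp_all
  finally show ?thesis by (rule le_less_trans) (simp add: ennreal_add_less_top)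
qed

text \<open>In polar coordinates the singular factor cancels against \<open>|s| ^ (n - 1)\<close>,
  leaving 1 / (1 + s^2) on each line and the finite measure of the sphere. This weight is the common
  majorant for all convolution integrands.\<close>

lemma integrable_riesz_weight:
  "integrable lborel (\<lambda>z::real^'n::finite. 1 / (norm z ^ (CARD('n) - 1) * (1 + (norm z)\<^sup>2)))"
proof (rule integrableI_nonneg)
  let ?h = "\<lambda>z::real^'n. ennreal (1 / (norm z ^ (CARD('n) - 1) * (1 + (norm z)\<^sup>2)))"
  have "2 * (\<integral>\<^sup>+z. ?h z \<partial>lborel) =
    (\<integral>\<^sup>+\<xi>. \<integral>\<^sup>+s. ennreal (\<bar>s\<bar> ^ (CARD('n) - 1)) * ?h (s *\<^sub>R \<xi>) \<partial>lborel \<partial>sphere_measure)"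
    by (rule nn_integral_line_polar[symmetric]) measurable
  also have "\<dots> \<le> (\<integral>\<^sup>+\<xi>. \<integral>\<^sup>+s. ennreal (1 / (1 + s\<^sup>2)) \<partial>lborel \<partial>(sphere_measure :: (real^'n) measure))"
  proof (intro nn_integral_mono)
    fix \<xi> :: "real^'n" and s :: real
    assume "\<xi> \<in> space sphere_measure"
    then have \<xi>: "norm (s *\<^sub>R \<xi>) = \<bar>s\<bar>" by simp
    \<comment> \<open>An inequality and not an equality, because at \<open>s = 0\<close> the left
      side can be 0.\<close>
    have "\<bar>s\<bar> ^ (CARD('n) - 1) * (1 / (\<bar>s\<bar> ^ (CARD('n) - 1) * (1 + s\<^sup>2))) \<le> 1 / (1 + s\<^sup>2)"
      by (cases "\<bar>s\<bar> ^ (CARD('n) - 1) = 0") simp_all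
    then show "ennreal (\<bar>s\<bar> ^ (CARD('n) - 1)) * ?h (s *\<^sub>R \<xi>) \<le> ennreal (1 / (1 + s\<^sup>2))"
      unfolding \<xi> by (subst ennreal_mult'[symmetric]) (auto intro: ennreal_leI)
  qed
  also have "\<dots> = (\<integral>\<^sup>+s. ennreal (1 / (1 + s\<^sup>2)) \<partial>lborel) * emeasure (sphere_measure :: (real^'n) measure) (sphere 0 1)"
    by (simp only: nn_integral_const space_sphere_measure)
  also have "\<dots> < \<infinity>"
    using nn_integral_inverse_1_plus_square_finite
      finite_measure.emeasure_finite[OF finite_measure_sphere_measure, of "sphere 0 1 :: (real^'n) set"]
    by (simp add: ennreal_mult_less_top less_top)
  finally show "(\<integral>\<^sup>+z. ?h z \<partial>lborel) < \<infinity>"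
    by (auto simp add: ennreal_mult_less_top)
qed auto

subsection \<open>Contractions with symmetric powers\<close>

lemma sum_lists_append:
  "(\<Sum>qs | length (qs :: 'n::finite list) = m + r. F qs) =
   (\<Sum>js | length js = m. \<Sum>ps | length ps = r. F (js @ ps))"
proof -
  have "(\<Sum>js | length js = m. \<Sum>ps | length ps = r. F (js @ ps)) =
      (\<Sum>(js, ps) \<in> {js. length js = m} \<times> {ps. length ps = r}. F (js @ ps))"
    by (rule sum.cartesian_product)
  also have "\<dots> = (\<Sum>qs | length qs = m + r. F qs)"
    by (rule sum.reindex_bij_witness[of _ "\<lambda>qs. (take m qs, drop m qs)" "\<lambda>(js, ps). js @ ps"]) auto
  finally show ?thesis ..
qed

lemma tensor_pow_Nil [simp]: "tensor_pow x [] = 1"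
  by (simp add: tensor_pow_def)

lemma tensor_pow_Cons [simp]: "tensor_pow x (i # is) = of_real (x $ i) * tensor_pow x is"
  by (simp add: tensor_pow_def)

lemma tensor_pow_append: "tensor_pow x (is @ js) = tensor_pow x is * tensor_pow x js"
  by (simp add: tensor_pow_def)

lemma tensor_pow_scaleR: "tensor_pow (c *\<^sub>R x) is = of_real c ^ length is * tensor_pow x is"
  by (induction "is") auto

lemma tensor_pow_minus: "tensor_pow (- x) is = (-1) ^ length is * tensor_pow x is"
  by (induction "is") auto

lemma norm_tensor_pow_le: "norm (tensor_pow x is) \<le> norm (x :: real^'n::finite) ^ length is"
  by (induction "is") (auto simp: norm_mult intro!: mult_mono component_le_norm_cart)

text \<open>A product depends only on the multiset of its factors, and permuting the list keeps the
  multiset of indices.\<close>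

lemma tensor_pow_permute_list:
  assumes "\<pi> permutes {..<length is}"
  shows "tensor_pow x (permute_list \<pi> is) = tensor_pow x is"
proof -
  have "tensor_pow x js = of_real (prod_mset (image_mset (($) x) (mset js)))" for js
    by (simp add: tensor_pow_def prod_mset_prod_list[symmetric])
  then show ?thesis using assms by simp
qed

lemma borel_measurable_tensor_pow [measurable]:
  "(\<lambda>x :: real^'n::finite. tensor_pow x is) \<in> borel_measurable borel"
  by (induction "is") auto

lemma tensor_pow_contract:
  fixes x y :: "real^'n::finite"
  shows "(\<Sum>is | length is = r. tensor_pow x is * tensor_pow y is) = of_real ((x \<bullet> y) ^ r)"
proof (induction r)
  case (Suc r)
  have "(\<Sum>is | length is = Suc r. tensor_pow x is * tensor_pow y is) =
      (\<Sum>js | length (js :: 'n list) = 1. tensor_pow x js * tensor_pow y js) * of_real ((x \<bullet> y) ^ r)"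
    using sum_lists_append[where m = 1 and r = r and F = "\<lambda>is. tensor_pow x is * tensor_pow y is"]
    unfolding Suc.IH[symmetric] sum_product by (simp add: tensor_pow_append mult_ac)
  also have "(\<Sum>js | length (js :: 'n list) = 1. tensor_pow x js * tensor_pow y js) =
      (\<Sum>i\<in>UNIV. of_real (x $ i) * of_real (y $ i))"
    by (rule sum.reindex_bij_witness[of _ "\<lambda>i. [i]" hd]) (auto simp: length_Suc_conv)
  finally show ?case by (simp add: inner_vec_def)
qed simp

text \<open>As \<open>tensor_pow w\<close> is invariant under permutations, each \<pi> may be
  applied to both factors at once and then merely relabels the sum over lists. The average thus
  consists of \<open>fact N\<close> equal terms.\<close>

lemma symmetrize_contract:
  fixes T :: "'n::finite tensor" and w :: "real^'n"
  shows "(\<Sum>is | length is = N. symmetrize T is * tensor_pow w is) =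
    (\<Sum>is | length is = N. T is * tensor_pow w is)"
proof -
  let ?L = "{is :: 'n list. length is = N}" and ?P = "{\<pi>. \<pi> permutes {..<N}}"
  have perm: "(\<Sum>is\<in>?L. T (permute_list \<pi> is) * tensor_pow w (permute_list \<pi> is)) =
      (\<Sum>is\<in>?L. T is * tensor_pow w is)" if \<pi>: "\<pi> permutes {..<N}" for \<pi>
  proof (rule sum.reindex_bij_witness[of _ "permute_list (inv \<pi>)" "permute_list \<pi>"])
    fix "is" :: "'n list" assume L: "is \<in> ?L"
    show "permute_list (inv \<pi>) (permute_list \<pi> is) = is"
      using L \<pi> permutes_inv[OF \<pi>]
      by (subst permute_list_compose[symmetric]) (auto simp: permutes_inv_o)
    show "permute_list \<pi> (permute_list (inv \<pi>) is) = is"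
      using L \<pi> permutes_inv[OF \<pi>]
      by (subst permute_list_compose[symmetric]) (auto simp: permutes_inv_o)
  qed auto
  have "(\<Sum>is\<in>?L. symmetrize T is * tensor_pow w is) =
      (\<Sum>is\<in>?L. \<Sum>\<pi>\<in>?P. T (permute_list \<pi> is) * tensor_pow w (permute_list \<pi> is) / fact N)"
    by (intro sum.cong refl)
       (auto simp: symmetrize_def sum_distrib_right sum_divide_distrib tensor_pow_permute_list intro!: sum.cong)
  also have "\<dots> = (\<Sum>\<pi>\<in>?P. (\<Sum>is\<in>?L. T (permute_list \<pi> is) * tensor_pow w (permute_list \<pi> is)) / fact N)"
    by (subst sum.swap) (simp add: sum_divide_distrib)
  also have "\<dots> = (\<Sum>\<pi>\<in>?P. (\<Sum>is\<in>?L. T is * tensor_pow w is) / fact N)"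
    by (intro sum.cong refl) (simp add: perm)
  also have "\<dots> = (\<Sum>is\<in>?L. T is * tensor_pow w is)"
    using card_permutations[of "{..<N}" N] by simp
  finally show ?thesis .
qed

text \<open>All index sums of one convolution term collapse to scalars here: the contraction of
  \<open>T\<close> alone, and a power of the inner product that matches a term of the binomial
  expansion.\<close>

lemma sym_prod_contract:
  fixes T :: "'n::finite tensor" and y w :: "real^'n"
  shows "(\<Sum>js | length js = m. \<Sum>ps | length ps = r.
      sym_prod m T (tensor_pow y) (js @ ps) * tensor_pow w (js @ ps)) =
    (\<Sum>js | length js = m. T js * tensor_pow w js) * of_real ((y \<bullet> w) ^ r)"
proof -
  have "(\<Sum>js | length js = m. \<Sum>ps | length ps = r.
      sym_prod m T (tensor_pow y) (js @ ps) * tensor_pow w (js @ ps)) =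
    (\<Sum>qs | length qs = m + r. T (take m qs) * tensor_pow y (drop m qs) * tensor_pow w qs)"
    unfolding sym_prod_def
      sum_lists_append[symmetric, where F = "\<lambda>qs. symmetrize (\<lambda>is. T (take m is) * tensor_pow y (drop m is)) qs * tensor_pow w qs"]
    by (subst symmetrize_contract) (simp add: mult.assoc)
  also have "\<dots> = (\<Sum>js | length js = m. \<Sum>ps | length ps = r.
      (T js * tensor_pow w js) * (tensor_pow y ps * tensor_pow w ps))"
    unfolding sum_lists_append by (intro sum.cong refl) (auto simp: tensor_pow_append)
  also have "\<dots> = (\<Sum>js | length js = m. T js * tensor_pow w js) *
      (\<Sum>ps | length ps = r. tensor_pow y ps * tensor_pow w ps)"
    by (simp add: sum_product)
  finally show ?thesis unfolding tensor_pow_contract .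
qed

subsection \<open>Rapidly decreasing functions\<close>

text \<open>The weight \<open>1 + norm y\<close> is preferred to \<open>norm y\<close> because it is
  at least 1, so that one exponent controls all smaller ones, and because it is submultiplicative
  under translation.\<close>

definition rapidly_decreasing :: "('a::euclidean_space \<Rightarrow> complex) \<Rightarrow> bool" where
  "rapidly_decreasing g \<longleftrightarrow> g \<in> borel_measurable borel \<and>
     (\<forall>N. \<exists>C. \<forall>y. (1 + norm y) ^ N * norm (g y) \<le> C)"

lemma rapidly_decreasing_measurable: "rapidly_decreasing g \<Longrightarrow> g \<in> borel_measurable borel"
  by (simp add: rapidly_decreasing_def)

text \<open>The empty list of derivatives gives continuity, hence measurability, and bounds with the
  weights \<open>norm y ^ 0\<close> and \<open>norm y ^ N\<close>. These combine by (1+r)^N \<le> (2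
  max(1,r))^N \<le> 2^N (1 + r^N).\<close>

lemma schwartz_rapidly_decreasing:
  assumes "g \<in> schwartz"
  shows "rapidly_decreasing g"
proof -
  have g: "(\<forall>x. g differentiable (at x))" "bounded (range (\<lambda>x. norm x ^ N *\<^sub>R g x))" for N
    using assms iter_partial.simps(1)[of g] unfolding schwartz_def mem_Collect_eq by metis+
  have "continuous_on UNIV g"
    using g(1) by (auto intro: continuous_at_imp_continuous_on differentiable_imp_continuous_within)
  then have "g \<in> borel_measurable borel" by (rule borel_measurable_continuous_onI)
  moreover have "\<exists>C. \<forall>y. (1 + norm y) ^ N * norm (g y) \<le> C" for N
  proof -
    obtain A where A: "\<And>y. norm y ^ 0 * norm (g y) \<le> A"
      using g(2)[of 0] by (auto simp: bounded_iff)
    obtain B where B: "\<And>y. norm y ^ N * norm (g y) \<le> B"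
      using g(2)[of N] by (auto simp: bounded_iff)
    have "(1 + norm y) ^ N * norm (g y) \<le> 2 ^ N * (A + B)" for y
    proof -
      have "(1 + norm y) ^ N \<le> (2 * max 1 (norm y)) ^ N" by (intro power_mono) auto
      also have "\<dots> \<le> 2 ^ N * (1 + norm y ^ N)"
        unfolding power_mult_distrib by (intro mult_left_mono) (auto simp: max_def)
      finally have "(1 + norm y) ^ N * norm (g y) \<le> 2 ^ N * (1 + norm y ^ N) * norm (g y)"
        by (rule mult_right_mono) simp
      also have "\<dots> = 2 ^ N * (norm y ^ 0 * norm (g y) + norm y ^ N * norm (g y))"
        by (simp add: algebra_simps)
      also have "\<dots> \<le> 2 ^ N * (A + B)"
        using A[of y] B[of y] by (intro mult_left_mono add_mono) auto
      finally show ?thesis .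
    qed
    then show ?thesis by blast
  qed
  ultimately show ?thesis by (simp add: rapidly_decreasing_def)
qed

lemma rapidly_decreasing_sum:
  assumes "\<And>i. i \<in> I \<Longrightarrow> rapidly_decreasing (g i)"
  shows "rapidly_decreasing (\<lambda>y. \<Sum>i\<in>I. g i y)"
  unfolding rapidly_decreasing_def
proof (intro conjI allI)
  show "(\<lambda>y. \<Sum>i\<in>I. g i y) \<in> borel_measurable borel"
    using assms by (intro borel_measurable_sum) (auto simp: rapidly_decreasing_def)
  fix N
  have "\<exists>C. \<forall>i\<in>I. \<forall>y. (1 + norm y) ^ N * norm (g i y) \<le> C i"
    using assms unfolding rapidly_decreasing_def by (intro bchoice) blast
  then obtain C where C: "\<And>i y. i \<in> I \<Longrightarrow> (1 + norm y) ^ N * norm (g i y) \<le> C i" by blast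
  have "(1 + norm y) ^ N * norm (\<Sum>i\<in>I. g i y) \<le> sum C I" for y
  proof -
    have "(1 + norm y) ^ N * norm (\<Sum>i\<in>I. g i y) \<le> (1 + norm y) ^ N * (\<Sum>i\<in>I. norm (g i y))"
      by (intro mult_left_mono norm_sum) simp
    also have "\<dots> \<le> sum C I"
      unfolding sum_distrib_left by (intro sum_mono C)
    finally show ?thesis .
  qed
  then show "\<exists>C. \<forall>y. (1 + norm y) ^ N * norm (\<Sum>i\<in>I. g i y) \<le> C" by blast
qed

lemma rapidly_decreasing_mult:
  fixes g h :: "'a::euclidean_space \<Rightarrow> complex"
  assumes "rapidly_decreasing g" "h \<in> borel_measurable borel" "\<And>y. norm (h y) \<le> (1 + norm y) ^ K"
  shows "rapidly_decreasing (\<lambda>y. g y * h y)"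
  unfolding rapidly_decreasing_def
proof (intro conjI allI)
  show "(\<lambda>y. g y * h y) \<in> borel_measurable borel"
    using assms by (auto simp: rapidly_decreasing_def)
  fix N
  obtain C where C: "\<And>y. (1 + norm y) ^ (N + K) * norm (g y) \<le> C"
    using assms(1) unfolding rapidly_decreasing_def by blast
  have "(1 + norm y) ^ N * norm (g y * h y) \<le> C" for y
  proof -
    have "(1 + norm y) ^ N * norm (g y * h y) \<le> (1 + norm y) ^ N * (norm (g y) * (1 + norm y) ^ K)"
      unfolding norm_mult by (intro mult_left_mono assms) auto
    also have "\<dots> \<le> C" using C[of y] by (simp add: power_add mult_ac)
    finally show ?thesis .
  qed
  then show "\<exists>C. \<forall>y. (1 + norm y) ^ N * norm (g y * h y) \<le> C" by blast
qed

text \<open>Each permutation contributes a component of \<open>f\<close> times a monomial of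
  polynomial growth. The bound \<open>m \<le> length qs\<close> ensures that \<open>take m\<close>
  yields a list of length \<open>m\<close>, at which \<open>f\<close> is meaningful.\<close>

lemma rapidly_decreasing_sym_prod:
  fixes f :: "'n::finite tensor_field"
  assumes "\<And>js. length js = m \<Longrightarrow> rapidly_decreasing (\<lambda>y. f y js)" "m \<le> length qs"
  shows "rapidly_decreasing (\<lambda>y. sym_prod m (f y) (tensor_pow y) qs)"
proof -
  have bnd: "norm (tensor_pow y is) \<le> (1 + norm y) ^ length is" for y :: "real^'n" and "is"
    by (rule order_trans[OF norm_tensor_pow_le power_mono]) auto
  have "rapidly_decreasing (\<lambda>y. f y (take m (permute_list \<pi> qs)) * tensor_pow y (drop m (permute_list \<pi> qs)))" for \<pi>
    by (rule rapidly_decreasing_mult[OF _ _ bnd]) (use assms in auto)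
  then have "rapidly_decreasing (\<lambda>y. \<Sum>\<pi> | \<pi> permutes {..<length qs}.
      f y (take m (permute_list \<pi> qs)) * tensor_pow y (drop m (permute_list \<pi> qs)))"
    by (rule rapidly_decreasing_sum)
  then have "rapidly_decreasing (\<lambda>y. (\<Sum>\<pi> | \<pi> permutes {..<length qs}.
      f y (take m (permute_list \<pi> qs)) * tensor_pow y (drop m (permute_list \<pi> qs))) * inverse (fact (length qs)))"
    by (rule rapidly_decreasing_mult[where K = 0]) (auto simp: norm_inverse inverse_le_1_iff)
  then show ?thesis by (simp add: sym_prod_def symmetrize_def divide_inverse)
qed

text \<open>The exponent \<open>j\<close> is the growth left after the singular factor is split off;
  it is \<open>k - l\<close> in the application to the kernels.\<close>

lemma integrable_rapidly_decreasing_riesz: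
  fixes g w :: "real^'n::finite \<Rightarrow> complex"
  assumes g: "rapidly_decreasing g" and w [measurable]: "w \<in> borel_measurable borel"
    and w_le: "\<And>z. norm (w z) \<le> norm z ^ j / norm z ^ (CARD('n) - 1)"
  shows "integrable lborel (\<lambda>z. g (x + z) * w z)"
proof -
  have [measurable]: "g \<in> borel_measurable borel" by (rule rapidly_decreasing_measurable[OF g])
  \<comment> \<open>Of the \<open>j + 2\<close> powers of decay, \<open>j\<close> absorb the growth
    of \<open>w\<close> and two provide the factor 1 / (1 + |z|^2) of the majorant.\<close>
  obtain C where C: "\<And>y. (1 + norm y) ^ (j + 2) * norm (g y) \<le> C"
    using g unfolding rapidly_decreasing_def by blast
  define D where "D = (1 + norm x) ^ (j + 2) * C"
  have D: "norm z ^ j * (1 + (norm z)\<^sup>2) * norm (g (x + z)) \<le> D" for z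
  proof -
    have "1 + (norm z)\<^sup>2 \<le> (1 + norm z)\<^sup>2"
      by (simp add: power2_eq_square algebra_simps)
    then have "norm z ^ j * (1 + (norm z)\<^sup>2) \<le> (1 + norm z) ^ j * (1 + norm z)\<^sup>2"
      by (intro mult_mono power_mono) auto
    also have "\<dots> = (1 + norm z) ^ (j + 2)" by (simp add: power_add power2_eq_square)
    \<comment> \<open>A Peetre-type inequality moves the weight from \<open>z\<close> to
      \<open>x + z\<close>, where the decay of \<open>g\<close> is known, at the cost of a factor
      depending on the fixed \<open>x\<close> only.\<close>
    also have "\<dots> \<le> ((1 + norm x) * (1 + norm (x + z))) ^ (j + 2)"
    proof (rule power_mono)
      have "norm z \<le> norm x + norm (x + z)"
        using norm_triangle_ineq4[of "x + z" x] by simp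
      moreover have "0 \<le> norm x * norm (x + z)" by simp
      moreover have "(1 + norm x) * (1 + norm (x + z)) = 1 + norm x + norm (x + z) + norm x * norm (x + z)"
        by (simp add: algebra_simps)
      ultimately show "1 + norm z \<le> (1 + norm x) * (1 + norm (x + z))" by linarith
    qed simp
    finally have "norm z ^ j * (1 + (norm z)\<^sup>2) * norm (g (x + z)) \<le>
        ((1 + norm x) * (1 + norm (x + z))) ^ (j + 2) * norm (g (x + z))"
      by (rule mult_right_mono) simp
    also have "\<dots> = (1 + norm x) ^ (j + 2) * ((1 + norm (x + z)) ^ (j + 2) * norm (g (x + z)))"
      by (simp add: power_mult_distrib mult_ac)
    also have "\<dots> \<le> D" unfolding D_def by (intro mult_left_mono C) simp
    finally show ?thesis .
  qed
  show ?thesis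
  proof (rule Bochner_Integration.integrable_bound)
    show "integrable lborel (\<lambda>z::real^'n. D * (1 / (norm z ^ (CARD('n) - 1) * (1 + (norm z)\<^sup>2))))"
      by (intro integrable_mult_right integrable_riesz_weight)
    show "AE z in lborel. norm (g (x + z) * w z) \<le>
        norm (D * (1 / (norm z ^ (CARD('n) - 1) * (1 + (norm z)\<^sup>2))))"
    proof (rule AE_I2)
      fix z :: "real^'n"
      have pos: "1 + (norm z)\<^sup>2 > 0" by (simp add: add_pos_nonneg)
      \<comment> \<open>Nothing is assumed about \<open>c\<close>, which is the singular power of
        \<open>norm z\<close>: for \<open>c = 0\<close> both sides are 0.\<close>
      have cancel: "a * (b / c) = (b * p * a) * (1 / (c * p))" if "p \<noteq> 0" for a b c p :: real
        using that by simp
      have "norm (g (x + z) * w z) \<le> norm (g (x + z)) * (norm z ^ j / norm z ^ (CARD('n) - 1))"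
        unfolding norm_mult by (intro mult_left_mono w_le) simp
      also have "\<dots> = (norm z ^ j * (1 + (norm z)\<^sup>2) * norm (g (x + z))) *
          (1 / (norm z ^ (CARD('n) - 1) * (1 + (norm z)\<^sup>2)))"
        using pos by (intro cancel) simp
      also have "\<dots> \<le> D * (1 / (norm z ^ (CARD('n) - 1) * (1 + (norm z)\<^sup>2)))"
        using pos by (intro mult_right_mono D) auto
      finally show "norm (g (x + z) * w z) \<le>
          norm (D * (1 / (norm z ^ (CARD('n) - 1) * (1 + (norm z)\<^sup>2))))"
        by (rule order_trans) (simp only: real_norm_def abs_ge_self)
    qed
  qed measurable
qed

subsection \<open>The normal operator as a convolution\<close>

text \<open>The substitution \<open>y = x + z\<close> places the singularity at the origin. The
  reflected argument \<open>- z\<close> is what later produces the signs (-1)^(k+l).\<close>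

lemma convolution_eq_shift:
  fixes g h :: "real^'n::finite \<Rightarrow> complex"
  assumes [measurable]: "g \<in> borel_measurable borel" "h \<in> borel_measurable borel"
  shows "convolution g h x = (LINT z|lborel. g (x + z) * h (- z))"
proof -
  have "convolution g h x = (LINT y|distr lborel borel ((+) x). g y * h (x - y))"
    by (simp add: convolution_def lborel_distr_plus)
  also have "\<dots> = (LINT z|lborel. g (x + z) * h (- z))"
    by (subst integral_distr) simp_all
  finally show ?thesis .
qed

text \<open>Used with \<open>a = (x + z) \<bullet> z\<close>, \<open>b = x \<bullet> z\<close>,
  \<open>r = norm z\<close> and \<open>n1 = n - 1\<close>. The term of index \<open>l\<close>
  contains (-r^2)^(k-l): its sign equals (-1)^(k+l) by parity, and its powers of \<open>r\<close>
  reduce the \<open>2 * k\<close> in the denominator to \<open>2 * l\<close>.\<close>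

lemma ray_kernel_expansion:
  fixes a r b :: real
  assumes "b = a - r\<^sup>2" "0 < n1"
  shows "(b * a) ^ k / r ^ (n1 + 2 * m + 2 * k) =
    (\<Sum>l=0..k. real (k choose l) * ((-1) ^ (k + l) * a ^ (k + l) / r ^ (2 * m + 2 * l + n1)))"
proof (cases "r = 0")
  case True
  then show ?thesis using assms by (simp add: power_0_left)
next
  case False
  have "b ^ k = (\<Sum>l\<le>k. real (k choose l) * a ^ l * (- (r\<^sup>2)) ^ (k - l))"
    using binomial_ring[of a "- (r\<^sup>2)" k] assms by simp
  then have "(b * a) ^ k / r ^ (n1 + 2 * m + 2 * k) =
      (\<Sum>l\<le>k. real (k choose l) * a ^ l * (- (r\<^sup>2)) ^ (k - l) * a ^ k / r ^ (n1 + 2 * m + 2 * k))"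
    by (simp add: power_mult_distrib sum_distrib_right sum_divide_distrib)
  also have "\<dots> = (\<Sum>l\<le>k. real (k choose l) * ((-1) ^ (k + l) * a ^ (k + l) / r ^ (2 * m + 2 * l + n1)))"
  proof (intro sum.cong refl)
    fix l assume "l \<in> {..k}"
    then obtain d where k: "k = l + d" by (auto simp: le_iff_add)
    have "(- (r\<^sup>2)) ^ d = (-1) ^ d * r ^ (2 * d)"
      by (subst power_minus) (simp add: power_mult)
    moreover have "(-1 :: real) ^ (k + l) = (-1) ^ d"
      by (simp add: k power_add flip: mult_2)
    ultimately show "real (k choose l) * a ^ l * (- (r\<^sup>2)) ^ (k - l) * a ^ k / r ^ (n1 + 2 * m + 2 * k) =
        real (k choose l) * ((-1) ^ (k + l) * a ^ (k + l) / r ^ (2 * m + 2 * l + n1))"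
      using False by (simp add: k power_add field_simps)
  qed
  finally show ?thesis by (simp add: atLeast0AtMost)
qed

text \<open>At \<open>z = 0\<close> all quotients are \<open>0\<close>, because the exponents of the norm are positive
  for \<open>n \<ge> 2\<close>; hence \<open>ray_density_expansion\<close> holds there too.\<close>

definition ray_density :: "nat \<Rightarrow> nat \<Rightarrow> ('n::finite) tensor_field \<Rightarrow> 'n list \<Rightarrow> real^'n \<Rightarrow> real^'n \<Rightarrow> complex" where
  "ray_density m k f ii x z =
     (\<Sum>js | length js = m. f (x + z) js * tensor_pow z js) * tensor_pow z ii *
     of_real (((x \<bullet> z) * ((x + z) \<bullet> z)) ^ k / norm z ^ (CARD('n) - 1 + 2 * m + 2 * k))"

text \<open>Homogeneity: the contraction of \<open>f\<close> and the factor with indices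
  \<open>ii\<close> give s^m each, the two inner products together s^(2k). The product is
  |s|^(2m+2k), without a sign, and together with |s|^(n-1) it cancels the denominator.\<close>

lemma ray_density_line:
  fixes x \<xi> :: "real^'n::finite"
  assumes "norm \<xi> = 1" "s \<noteq> 0" "length ii = m"
  shows "\<bar>s\<bar> ^ (CARD('n) - 1) *\<^sub>R ray_density m k f ii x (s *\<^sub>R \<xi>) =
    of_real ((x \<bullet> \<xi>) ^ k) * tensor_pow \<xi> ii *
      (of_real ((x \<bullet> \<xi> + s) ^ k) * (\<Sum>js | length js = m. f (x + s *\<^sub>R \<xi>) js * tensor_pow \<xi> js))"
proof -
  let ?S = "\<Sum>js | length js = m. f (x + s *\<^sub>R \<xi>) js * tensor_pow \<xi> js"
  have "\<xi> \<bullet> \<xi> = 1" using assms(1) by (simp add: norm_eq_1)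
  then have inner: "(x + s *\<^sub>R \<xi>) \<bullet> (s *\<^sub>R \<xi>) = s * (x \<bullet> \<xi> + s)"
    by (simp add: inner_add_left algebra_simps)
  have S: "(\<Sum>js | length js = m. f (x + s *\<^sub>R \<xi>) js * tensor_pow (s *\<^sub>R \<xi>) js) = of_real (s ^ m) * ?S"
    unfolding sum_distrib_left by (intro sum.cong refl) (simp add: tensor_pow_scaleR)
  have even: "s ^ r * s ^ r = \<bar>s\<bar> ^ (2 * r)" for r
    by (simp add: power_mult power2_eq_square power_mult_distrib)
  have "((s * (x \<bullet> \<xi>)) * (s * (x \<bullet> \<xi> + s))) ^ k = \<bar>s\<bar> ^ (2 * k) * ((x \<bullet> \<xi>) ^ k * (x \<bullet> \<xi> + s) ^ k)"
    unfolding power_mult_distrib even[symmetric] by (simp only: mult_ac)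
  then have real: "\<bar>s\<bar> ^ (CARD('n) - 1) * (s ^ m * (s ^ m *
      (((s * (x \<bullet> \<xi>)) * (s * (x \<bullet> \<xi> + s))) ^ k / \<bar>s\<bar> ^ (CARD('n) - 1 + 2 * m + 2 * k)))) =
    (x \<bullet> \<xi>) ^ k * (x \<bullet> \<xi> + s) ^ k"
    using assms(2) unfolding mult.assoc[symmetric, of "s ^ m"] times_divide_eq_right[symmetric]
    by (simp only: even power_add) simp
  have "\<bar>s\<bar> ^ (CARD('n) - 1) *\<^sub>R ray_density m k f ii x (s *\<^sub>R \<xi>) =
    of_real (\<bar>s\<bar> ^ (CARD('n) - 1) * (s ^ m * (s ^ m *
      (((s * (x \<bullet> \<xi>)) * (s * (x \<bullet> \<xi> + s))) ^ k / \<bar>s\<bar> ^ (CARD('n) - 1 + 2 * m + 2 * k))))) *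
      (?S * tensor_pow \<xi> ii)"
    unfolding ray_density_def S inner using assms(1,3)
    by (simp add: tensor_pow_scaleR scaleR_conv_of_real[where 'a = complex] mult_ac)
  then show ?thesis unfolding real by (simp add: mult_ac)
qed

text \<open>Once the index sums are contracted, every term on the right contains the same tensor
  factors, and \<open>l\<close> enters only through the scalar sum of
  \<open>ray_kernel_expansion\<close>.\<close>

lemma ray_density_expansion:
  fixes x z :: "real^'n::finite"
  assumes "CARD('n) \<ge> 2" "length ii = m"
  shows "ray_density m k f ii x z =
    (\<Sum>l=0..k. of_nat (k choose l) * (\<Sum>js | length js = m. \<Sum>ps | length ps = k + l.
       sym_prod m (f (x + z)) (tensor_pow (x + z)) (js @ ps) *
       (tensor_pow (- z) (ii @ js @ ps) / of_real (norm (- z) ^ (2 * m + 2 * l + CARD('n) - 1)))))"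
proof -
  let ?S = "\<Sum>js | length js = m. f (x + z) js * tensor_pow z js"
  let ?a = "(x + z) \<bullet> z"
  have n1: "2 * m + 2 * l + CARD('n) - 1 = 2 * m + 2 * l + (CARD('n) - 1)" for l
    using assms(1) by simp
  have "(\<Sum>js | length js = m. \<Sum>ps | length ps = k + l.
       sym_prod m (f (x + z)) (tensor_pow (x + z)) (js @ ps) *
       (tensor_pow (- z) (ii @ js @ ps) / of_real (norm (- z) ^ (2 * m + 2 * l + CARD('n) - 1)))) =
     (\<Sum>js | length js = m. \<Sum>ps | length ps = k + l.
       sym_prod m (f (x + z)) (tensor_pow (x + z)) (js @ ps) * tensor_pow z (js @ ps)) *
     (tensor_pow z ii * of_real ((-1) ^ (k + l) / norm z ^ (2 * m + 2 * l + (CARD('n) - 1))))" for l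
    unfolding sum_distrib_right n1
  proof (intro sum.cong refl)
    fix js ps :: "'n list"
    assume "js \<in> {js. length js = m}" "ps \<in> {ps. length ps = k + l}"
    \<comment> \<open>Both \<open>ii\<close> and \<open>js\<close> have length \<open>m\<close>, so
      their signs cancel and only those of \<open>ps\<close> remain.\<close>
    then have "(-1 :: complex) ^ length (ii @ js @ ps) = (-1) ^ (k + l)"
      using assms(2) by (simp add: power_add flip: power_mult_distrib)
    then show "sym_prod m (f (x + z)) (tensor_pow (x + z)) (js @ ps) *
        (tensor_pow (- z) (ii @ js @ ps) / of_real (norm (- z) ^ (2 * m + 2 * l + (CARD('n) - 1)))) =
      sym_prod m (f (x + z)) (tensor_pow (x + z)) (js @ ps) * tensor_pow z (js @ ps) *
        (tensor_pow z ii * of_real ((-1) ^ (k + l) / norm z ^ (2 * m + 2 * l + (CARD('n) - 1))))"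
      unfolding tensor_pow_minus by (simp add: tensor_pow_append mult_ac)
  qed
  note inner_sum = this[unfolded sym_prod_contract]
  have "(\<Sum>l=0..k. of_nat (k choose l) * (\<Sum>js | length js = m. \<Sum>ps | length ps = k + l.
       sym_prod m (f (x + z)) (tensor_pow (x + z)) (js @ ps) *
       (tensor_pow (- z) (ii @ js @ ps) / of_real (norm (- z) ^ (2 * m + 2 * l + CARD('n) - 1))))) =
    (\<Sum>l=0..k. of_nat (k choose l) * (?S * of_real (?a ^ (k + l)) *
       (tensor_pow z ii * of_real ((-1) ^ (k + l) / norm z ^ (2 * m + 2 * l + (CARD('n) - 1))))))"
    by (simp only: inner_sum)
  also have "\<dots> = (\<Sum>l=0..k. ?S * tensor_pow z ii * of_real (real (k choose l) *
       ((-1) ^ (k + l) * ?a ^ (k + l) / norm z ^ (2 * m + 2 * l + (CARD('n) - 1)))))"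
    by (intro sum.cong refl) (simp add: mult_ac)
  also have "\<dots> = ?S * tensor_pow z ii * of_real (\<Sum>l=0..k. real (k choose l) *
       ((-1) ^ (k + l) * ?a ^ (k + l) / norm z ^ (2 * m + 2 * l + (CARD('n) - 1))))"
    by (simp only: of_real_sum sum_distrib_left)
  also have "\<dots> = ray_density m k f ii x z"
    unfolding ray_density_def
    by (subst ray_kernel_expansion) (use assms(1) in \<open>simp_all add: inner_add_left power2_norm_eq_inner\<close>)
  finally show ?thesis ..
qed

text \<open>Each ray integral is brought to the shape required by
  \<open>integral_line_polar\<close>. The hypothesis \<open>int\<close> serves Fubini there;
  measurability of the components serves the comparison of ray integrands up to a null set.\<close>

lemma normal_op_eq_integral:
  fixes f :: "'n::finite tensor_field"
  assumes ii: "length ii = m" and int: "integrable lborel (ray_density m k f ii x)"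
    and f: "\<And>js. length js = m \<Longrightarrow> (\<lambda>y. f y js) \<in> borel_measurable borel"
  shows "normal_op m k f x ii = 2 * (LINT z|lborel. ray_density m k f ii x z)"
proof -
  let ?D = "ray_density m k f ii x"
  let ?S = "\<lambda>y \<xi>. \<Sum>js | length js = m. f y js * tensor_pow \<xi> js"
  have D [measurable]: "?D \<in> borel_measurable borel"
    using borel_measurable_integrable[OF int] by simp
  have ray: "of_real ((x \<bullet> \<xi>) ^ k) * tensor_pow \<xi> ii * ray_transform m k f (x - (x \<bullet> \<xi>) *\<^sub>R \<xi>, \<xi>) =
      (LINT s|lborel. \<bar>s\<bar> ^ (CARD('n) - 1) *\<^sub>R ?D (s *\<^sub>R \<xi>))" if "\<xi> \<in> space sphere_measure" for \<xi>
  proof -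
    have \<xi>: "norm \<xi> = 1" using that by simp
    have fS: "(\<lambda>s::real. ?S (x + s *\<^sub>R \<xi>) \<xi>) \<in> borel_measurable borel"
    proof (intro borel_measurable_sum borel_measurable_times)
      fix js :: "'n list" assume "js \<in> {js. length js = m}"
      then show "(\<lambda>s::real. f (x + s *\<^sub>R \<xi>) js) \<in> borel_measurable borel"
        by (intro measurable_compose[OF _ f]) auto
    qed simp
    have "ray_transform m k f (x - (x \<bullet> \<xi>) *\<^sub>R \<xi>, \<xi>) =
        (LINT s|lborel. of_real ((x \<bullet> \<xi> + s) ^ k) * ?S (x + s *\<^sub>R \<xi>) \<xi>)"
      unfolding ray_transform_def prod.case
      by (subst lborel_integral_real_affine[of 1 _ "x \<bullet> \<xi>"])
         (simp_all add: algebra_simps del: of_real_power)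
    then have "of_real ((x \<bullet> \<xi>) ^ k) * tensor_pow \<xi> ii * ray_transform m k f (x - (x \<bullet> \<xi>) *\<^sub>R \<xi>, \<xi>) =
        (LINT s|lborel. of_real ((x \<bullet> \<xi>) ^ k) * tensor_pow \<xi> ii *
          (of_real ((x \<bullet> \<xi> + s) ^ k) * ?S (x + s *\<^sub>R \<xi>) \<xi>))"
      by (simp only: integral_mult_right_zero)
    \<comment> \<open>At \<open>s = 0\<close> the two integrands may differ, so they are compared
      almost everywhere, which calls for measurability of both.\<close>
    also have "\<dots> = (LINT s|lborel. \<bar>s\<bar> ^ (CARD('n) - 1) *\<^sub>R ?D (s *\<^sub>R \<xi>))"
    proof (rule integral_cong_AE)
      show "AE s in lborel. of_real ((x \<bullet> \<xi>) ^ k) * tensor_pow \<xi> ii *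
          (of_real ((x \<bullet> \<xi> + s) ^ k) * ?S (x + s *\<^sub>R \<xi>) \<xi>) = \<bar>s\<bar> ^ (CARD('n) - 1) *\<^sub>R ?D (s *\<^sub>R \<xi>)"
        using AE_lborel_singleton[of "0::real"]
        by eventually_elim (rule ray_density_line[OF \<xi> _ ii, symmetric])
      show "(\<lambda>s. of_real ((x \<bullet> \<xi>) ^ k) * tensor_pow \<xi> ii *
          (of_real ((x \<bullet> \<xi> + s) ^ k) * ?S (x + s *\<^sub>R \<xi>) \<xi>)) \<in> borel_measurable lborel"
        using fS by (intro borel_measurable_times) simp_all
      show "(\<lambda>s. \<bar>s\<bar> ^ (CARD('n) - 1) *\<^sub>R ?D (s *\<^sub>R \<xi>)) \<in> borel_measurable lborel"
        by measurable
    qed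
    finally show ?thesis .
  qed
  have "normal_op m k f x ii =
      (LINT \<xi>|sphere_measure. LINT s|lborel. \<bar>s\<bar> ^ (CARD('n) - 1) *\<^sub>R ?D (s *\<^sub>R \<xi>))"
    unfolding normal_op_def ray_adjoint_def
    by (rule Bochner_Integration.integral_cong[OF refl ray])
  also have "\<dots> = 2 * (LINT z|lborel. ?D z)"
    unfolding integral_line_polar[OF int] by (simp add: scaleR_conv_of_real)
  finally show ?thesis .
qed

theorem proposition4p1:
  fixes m k :: nat
    and f :: "('n::finite) tensor_field"
    and x :: "real^'n"
    and ii :: "'n list"
  assumes "k \<le> m"
    and "CARD('n) \<ge> 2"
    and "f \<in> schwartz_sym_fields m"
    and "length ii = m"
  shows "normal_op m k f x ii =
    2 * (\<Sum>l=0..k. of_nat (k choose l) *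
      (\<Sum>js | length js = m. \<Sum>ps | length ps = k + l.
         convolution
           (\<lambda>y. sym_prod m (f y) (tensor_pow y) (js @ ps))
           (\<lambda>y. tensor_pow y (ii @ js @ ps) / of_real (norm y ^ (2 * m + 2 * l + CARD('n) - 1)))
           x))"
proof -
  have f: "rapidly_decreasing (\<lambda>y. f y js)" if "length js = m" for js
    using assms(3) that by (intro schwartz_rapidly_decreasing) (auto simp: schwartz_sym_fields_def)
  define g where "g = (\<lambda>qs y. sym_prod m (f y) (tensor_pow y) qs)"
  define w where "w = (\<lambda>l qs (y :: real^'n).
    tensor_pow y (ii @ qs) / of_real (norm y ^ (2 * m + 2 * l + CARD('n) - 1)))"
  have g: "rapidly_decreasing (g qs)" if "m \<le> length qs" for qs
    unfolding g_def using f that by (rule rapidly_decreasing_sym_prod)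
  have w [measurable]: "w l qs \<in> borel_measurable borel" for l qs
    unfolding w_def by measurable
  \<comment> \<open>The numerator has degree 2m+k+l and the denominator 2m+2l+n-1;
    \<open>l \<le> k\<close> makes the excess \<open>k - l\<close> a genuine natural number.\<close>
  have w_le: "norm (w l qs (- z)) \<le> norm z ^ (k - l) / norm z ^ (CARD('n) - 1)"
    if "l \<le> k" "length qs = m + (k + l)" for l qs z
  proof (cases "z = 0")
    case False
    have len: "length (ii @ qs) = (2 * m + 2 * l) + (k - l)"
      using that assms(4) by simp
    have n1: "2 * m + 2 * l + CARD('n) - 1 = (2 * m + 2 * l) + (CARD('n) - 1)"
      using assms(2) by simp
    have "norm (w l qs (- z)) \<le> norm z ^ length (ii @ qs) / norm z ^ (2 * m + 2 * l + CARD('n) - 1)"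
      unfolding w_def using norm_tensor_pow_le[of "- z" "ii @ qs"]
      by (simp add: norm_divide norm_power divide_right_mono)
    also have "\<dots> = norm z ^ (k - l) / norm z ^ (CARD('n) - 1)"
      unfolding len n1 power_add using False by simp
    finally show ?thesis .
  qed (use assms(2) in \<open>simp add: w_def power_0_left\<close>)
  \<comment> \<open>Integrability of each single term, and not just of their sum, allows the
    integral to pass through the three finite sums below.\<close>
  have int: "integrable lborel (\<lambda>z. g qs (x + z) * w l qs (- z))"
    if "l \<le> k" "length qs = m + (k + l)" for l qs
    by (rule integrable_rapidly_decreasing_riesz[OF g _ w_le]) (use that in simp_all)
  have density: "ray_density m k f ii x = (\<lambda>z. \<Sum>l=0..k. of_nat (k choose l) *
      (\<Sum>js | length js = m. \<Sum>ps | length ps = k + l. g (js @ ps) (x + z) * w l (js @ ps) (- z)))"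
    unfolding g_def w_def by (rule ext, rule ray_density_expansion[OF assms(2,4)])
  \<comment> \<open>The density is not estimated itself; its integrability comes from the terms of
    its expansion.\<close>
  have "integrable lborel (ray_density m k f ii x)"
    unfolding density
    by (intro Bochner_Integration.integrable_sum integrable_mult_right int) auto
  then have "normal_op m k f x ii = 2 * (LINT z|lborel. ray_density m k f ii x z)"
    using assms(4) f by (intro normal_op_eq_integral rapidly_decreasing_measurable)
  also have "(LINT z|lborel. ray_density m k f ii x z) = (\<Sum>l=0..k. of_nat (k choose l) *
      (\<Sum>js | length js = m. \<Sum>ps | length ps = k + l. LINT z|lborel. g (js @ ps) (x + z) * w l (js @ ps) (- z)))"
  proof -
    have "(LINT z|lborel. ray_density m k f ii x z) = (\<Sum>l=0..k. LINT z|lborel. of_nat (k choose l) *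
        (\<Sum>js | length js = m. \<Sum>ps | length ps = k + l. g (js @ ps) (x + z) * w l (js @ ps) (- z)))"
      unfolding density
      by (intro Bochner_Integration.integral_sum Bochner_Integration.integrable_sum integrable_mult_right int) auto
    also have "\<dots> = (\<Sum>l=0..k. of_nat (k choose l) *
        (\<Sum>js | length js = m. LINT z|lborel. (\<Sum>ps | length ps = k + l. g (js @ ps) (x + z) * w l (js @ ps) (- z))))"
      unfolding integral_mult_right_zero
      by (intro sum.cong refl arg_cong2[where f = "(*)"] Bochner_Integration.integral_sum
            Bochner_Integration.integrable_sum int) auto
    also have "\<dots> = (\<Sum>l=0..k. of_nat (k choose l) *
        (\<Sum>js | length js = m. \<Sum>ps | length ps = k + l. LINT z|lborel. g (js @ ps) (x + z) * w l (js @ ps) (- z)))"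
      by (intro sum.cong refl arg_cong2[where f = "(*)"] Bochner_Integration.integral_sum int) auto
    finally show ?thesis .
  qed
  also have "\<dots> = (\<Sum>l=0..k. of_nat (k choose l) *
      (\<Sum>js | length js = m. \<Sum>ps | length ps = k + l. convolution (g (js @ ps)) (w l (js @ ps)) x))"
    by (intro sum.cong refl arg_cong2[where f = "(*)"] convolution_eq_shift[symmetric]
          rapidly_decreasing_measurable g w) auto
  finally show ?thesis unfolding g_def w_def by simp
qed

end
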